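(* Let $n \geq 3$ and let $C_n$ be the cycle on $n$ vertices. If $n \not\equiv 1 \pmod 3$ and $n \neq 5$, then $\chi_s(S(C_n)) = 4$; otherwise (i.e. if $n \equiv 1 \pmod 3$ or $n = 5$), $\chi_s(S(C_n)) \leq 5$.
   Context: All graphs are finite, simple and undirected. A star coloring of a graph $G$ is a proper vertex coloring of $G$ in which every path on four vertices uses at least three distinct colors. The star chromatic number $\chi_s(G)$ is the least number of colors in a star coloring of $G$. The splitting graph $S(G)$ of a graph $G$ is obtained from $G$ by adding, for each vertex $v$ of $G$, a new vertex $v'$ whose neighborhood is $N(v')=N(v)$, the neighborhood of $v$ in $G$ (the new vertices are pairwise nonadjacent). *)

theory Defs
  imports "Graph_Theory.Graph_Theory" "HOL-Number_Theory.Cong"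
begin

text \<open>
  A finite simple undirected graph is a \<^locale>\<open>pair_graph\<close>: every edge is represented by
  its two opposite arcs.
\<close>

definition proper_coloring :: "'a pair_pre_digraph \<Rightarrow> ('a \<Rightarrow> nat) \<Rightarrow> bool" where
  "proper_coloring G c \<longleftrightarrow> (\<forall>(u, v) \<in> parcs G. c u \<noteq> c v)"

definition star_coloring :: "'a pair_pre_digraph \<Rightarrow> ('a \<Rightarrow> nat) \<Rightarrow> bool" where
  "star_coloring G c \<longleftrightarrow>
     proper_coloring G c \<and>
     (\<forall>p. vpath p (with_proj G) \<and> length p = 4 \<longrightarrow> card (c ` set p) \<ge> 3)"

definition star_chromatic_number :: "'a pair_pre_digraph \<Rightarrow> nat" where
  "star_chromatic_number G = (LEAST k. \<exists>c. star_coloring G c \<and> card (c ` pverts G) = k)"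

text \<open>In the splitting graph, \<^term>\<open>Inl v\<close> is the original vertex and \<^term>\<open>Inr v\<close> its copy.\<close>

definition splitting_graph :: "'a pair_pre_digraph \<Rightarrow> ('a + 'a) pair_pre_digraph" where
  "splitting_graph G =
     \<lparr> pverts = Inl ` pverts G \<union> Inr ` pverts G,
       parcs = (\<Union>(u, v) \<in> parcs G. {(Inl u, Inl v), (Inl u, Inr v), (Inr u, Inl v)}) \<rparr>"

text \<open>This is the cycle on \<open>n\<close> vertices for \<open>n \<ge> 3\<close> only.\<close>

definition cycle_graph :: "nat \<Rightarrow> nat pair_pre_digraph" where
  "cycle_graph n =
     \<lparr> pverts = {0..<n},
       parcs = (\<Union>i \<in> {0..<n}. {(i, (i + 1) mod n), ((i + 1) mod n, i)}) \<rparr>"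

lemma pair_graph_cycle_graph:
  assumes "n \<ge> 3"
  shows "pair_graph (cycle_graph n)"
proof
  fix e assume e: "e \<in> parcs (cycle_graph n)"
  show "fst e \<in> pverts (cycle_graph n)" "snd e \<in> pverts (cycle_graph n)"
    using e assms by (auto simp: cycle_graph_def)
  have "(i + 1) mod n \<noteq> i" if "i < n" for i
    using that assms by (cases "i + 1 = n") auto
  then show "fst e \<noteq> snd e"
    using e by (fastforce simp: cycle_graph_def)
next
  show "finite (pverts (cycle_graph n))"
    by (simp add: cycle_graph_def)
  show "finite (parcs (cycle_graph n))"
    by (simp add: cycle_graph_def)
  show "symmetric (with_proj (cycle_graph n))"
    by (auto simp: symmetric_def cycle_graph_def sym_def arcs_ends_def arc_to_ends_def)
qed

lemma pair_graph_splitting_graph: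
  assumes "pair_graph G"
  shows "pair_graph (splitting_graph G)"
proof -
  interpret pair_graph G by (fact assms)
  have symG: "(v, u) \<in> parcs G" if "(u, v) \<in> parcs G" for u v
    using that arcs_symmetric by blast
  show ?thesis
  proof
    fix e assume e: "e \<in> parcs (splitting_graph G)"
    show "fst e \<in> pverts (splitting_graph G)" "snd e \<in> pverts (splitting_graph G)"
      using e in_arcsD1 in_arcsD2 by (fastforce simp: splitting_graph_def)+
    show "fst e \<noteq> snd e"
      using e no_loops' by (fastforce simp: splitting_graph_def)
  next
    show "finite (pverts (splitting_graph G))"
      by (simp add: splitting_graph_def)
    show "finite (parcs (splitting_graph G))"
      by (auto simp: splitting_graph_def)
    show "symmetric (with_proj (splitting_graph G))"
      using symG
      by (fastforce simp: symmetric_def splitting_graph_def sym_def arcs_ends_def arc_to_ends_def)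
  qed
qed

lemma ex_star_coloring:
  assumes "pair_graph G"
  shows "\<exists>c. star_coloring G c"
proof -
  interpret pair_graph G by (fact assms)
  obtain c :: "'a \<Rightarrow> nat" where c: "inj_on c (pverts G)"
    using finite_imp_inj_to_nat_seg[of "pverts G"] by auto
  have "proper_coloring G c"
    unfolding proper_coloring_def
    using c no_loops' in_arcsD1 in_arcsD2 by (fastforce dest: inj_onD)
  moreover have "card (c ` set p) \<ge> 3" if p: "vpath p (with_proj G)" "length p = 4" for p
  proof -
    have "set p \<subseteq> pverts G" "distinct p"
      using p(1) by (auto simp: vpath_def vwalk_def)
    then show ?thesis
      using p(2) card_image[OF inj_on_subset[OF c]] distinct_card[of p] by simp
  qed
  ultimately show ?thesis
    unfolding star_coloring_def by blast
qed

end

theory Submission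
  imports Defs
begin

text \<open>
  Upper bounds. Only four consecutive positions of the cycle matter for a path on four vertices, and
  coloring the pairs (original, copy) periodically by \<open>(0, 0), (1, 3), (2, 3)\<close> leaves room for inserting one
  word of length 1 (with a fifth color) or of length 5 (without new colors) between two periods;
  only the cycle of length 5 needs a coloring of its own.

  Lower bound. With three colors, a vertex and its copy must agree exactly at every other position:
  two consecutive agreements bicolor a path through both copies, and at a disagreement the two cycle
  neighbors share a color, so two consecutive disagreements bicolor a path of the cycle. This
  alternation determines the colors of the copies up to renaming and forces a bicolored path through
  one copy.
\<close>

section \<open>Star colorings as proper colorings without bicolored paths\<close>

lemma card_ge_3_iff_not_alternating:
  assumes "p \<noteq> q" "q \<noteq> r" "r \<noteq> s"
  shows "card {p, q, r, s} \<ge> 3 \<longleftrightarrow> \<not> (p = r \<and> q = s)"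
  using assms by (auto simp: card_insert_if)

lemma (in pair_graph) vpath_4_iff:
  "vpath [u, v, w, x] (with_proj G) \<longleftrightarrow>
     distinct [u, v, w, x] \<and> {(u, v), (v, w), (w, x)} \<subseteq> parcs G"
  by (auto simp: vpath_def vwalk_def arcs_ends_def arc_to_ends_def dest: in_arcsD1 in_arcsD2)

text \<open>Properness separates consecutive colors, so a path on four vertices has at most two
  colors only if they alternate.\<close>

lemma star_coloring_iff:
  assumes "pair_graph G"
  shows "star_coloring G c \<longleftrightarrow>
    proper_coloring G c \<and>
    (\<forall>u v w x. (u, v) \<in> parcs G \<longrightarrow> (v, w) \<in> parcs G \<longrightarrow> (w, x) \<in> parcs G \<longrightarrow>
       distinct [u, v, w, x] \<longrightarrow> \<not> (c u = c w \<and> c v = c x))"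
proof -
  interpret pair_graph G by (fact assms)
  have len4: "length p = 4 \<longleftrightarrow> (\<exists>u v w x. p = [u, v, w, x])" for p :: "'a list"
    by (auto simp: length_Suc_conv numeral_eq_Suc)
  have "card (c ` set [u, v, w, x]) \<ge> 3 \<longleftrightarrow> \<not> (c u = c w \<and> c v = c x)"
    if "proper_coloring G c" "(u, v) \<in> parcs G" "(v, w) \<in> parcs G" "(w, x) \<in> parcs G" for u v w x
  proof -
    have "c u \<noteq> c v" "c v \<noteq> c w" "c w \<noteq> c x"
      using that by (auto simp: proper_coloring_def)
    then show ?thesis
      using card_ge_3_iff_not_alternating[of "c u" "c v" "c w" "c x"] by simp
  qed
  then show ?thesis
    unfolding star_coloring_def len4 using vpath_4_iff
    by (smt (verit) insert_subset empty_subsetI)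
qed

section \<open>Adjacency in the splitting graph of a cycle\<close>

abbreviation "scycle n \<equiv> splitting_graph (cycle_graph n)"

lemma pair_graph_scycle: "n \<ge> 3 \<Longrightarrow> pair_graph (scycle n)"
  by (intro pair_graph_splitting_graph pair_graph_cycle_graph)

lemma pverts_scycle: "pverts (scycle n) = Inl ` {0..<n} \<union> Inr ` {0..<n}"
  by (simp add: splitting_graph_def cycle_graph_def)

definition vertex_index :: "'a + 'a \<Rightarrow> 'a" where
  "vertex_index x = (case x of Inl i \<Rightarrow> i | Inr i \<Rightarrow> i)"

lemma vertex_index_simps [simp]: "vertex_index (Inl i) = i" "vertex_index (Inr i) = i"
  by (simp_all add: vertex_index_def)

text \<open>A copy inherits the neighborhood of its original, so apart from excluding pairs of
  copies only the positions on the cycle matter.\<close>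

lemma parcs_scycle_iff:
  "(x, y) \<in> parcs (scycle n) \<longleftrightarrow>
     (isl x \<or> isl y) \<and> vertex_index x < n \<and> vertex_index y < n \<and>
     (vertex_index y = (vertex_index x + 1) mod n \<or> vertex_index x = (vertex_index y + 1) mod n)"
proof -
  have "(i, j) \<in> parcs (cycle_graph n) \<longleftrightarrow> i < n \<and> j < n \<and> (j = (i + 1) mod n \<or> i = (j + 1) mod n)" for i j
    by (auto simp: cycle_graph_def)
  then show ?thesis
    by (cases x; cases y) (auto simp: splitting_graph_def)
qed

lemma inj_succ_mod:
  fixes i j n :: nat
  assumes "i < n" "j < n" "(i + 1) mod n = (j + 1) mod n"
  shows "i = j"
  using assms by (simp add: mod_Suc split: if_splits)

lemma vertex_index_neighbor:
  assumes "(x, y) \<in> parcs (scycle n)" "vertex_index y = (i + 1) mod n" "i < n"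
  shows "isl x \<or> isl y" "vertex_index x = i \<or> vertex_index x = (vertex_index y + 1) mod n"
  using assms inj_succ_mod[of "vertex_index x" n i] unfolding parcs_scycle_iff by metis+

section \<open>A local criterion for star colorings\<close>

text \<open>
  The arguments are the colors of an original vertex and of its copy at four consecutive positions
  of the cycle. A bicolored path is detected at its middle edge, which joins the second and the
  third position; the three lines treat the middle edges original--original, original--copy and
  copy--original.
\<close>

definition window_ok :: "nat \<times> nat \<Rightarrow> nat \<times> nat \<Rightarrow> nat \<times> nat \<Rightarrow> nat \<times> nat \<Rightarrow> bool" where
  "window_ok p q r s \<longleftrightarrow>
     fst q \<noteq> fst r \<and> \<not> (fst r \<in> {fst p, snd p, snd r} \<and> fst q \<in> {fst s, snd s, snd q}) \<and>
     fst q \<noteq> snd r \<and> \<not> (snd r \<in> {fst p, snd p, fst r} \<and> fst q = fst s) \<and>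
     snd q \<noteq> fst r \<and> \<not> (fst r = fst p \<and> snd q \<in> {fst s, snd s, fst q})"

definition word_coloring :: "(nat \<times> nat) list \<Rightarrow> nat + nat \<Rightarrow> nat" where
  "word_coloring w x = (case x of Inl i \<Rightarrow> fst (w ! i) | Inr i \<Rightarrow> snd (w ! i))"

lemma word_coloring_simps [simp]:
  "word_coloring w (Inl i) = fst (w ! i)" "word_coloring w (Inr i) = snd (w ! i)"
  by (simp_all add: word_coloring_def)

lemma star_coloring_word_coloring:
  assumes n: "length w = n" "n \<ge> 3"
    and ok: "\<And>i. i < n \<Longrightarrow>
      window_ok (w ! i) (w ! ((i + 1) mod n)) (w ! ((i + 2) mod n)) (w ! ((i + 3) mod n))"
  shows "star_coloring (scycle n) (word_coloring w)"
proof -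
  let ?c = "word_coloring w" and ?E = "parcs (scycle n)" and ?s = "\<lambda>i. (i + 1) mod n"
  have pred: "\<exists>i < n. j = ?s i" if "j < n" for j
  proof (cases j)
    case 0
    then show ?thesis using n by (intro exI[of _ "n - 1"]) auto
  next
    case (Suc k)
    then show ?thesis using that by (intro exI[of _ k]) auto
  qed
  have ok': "window_ok (w ! i) (w ! ?s i) (w ! ?s (?s i)) (w ! ?s (?s (?s i)))" if "i < n" for i
    using ok[OF that] by (simp add: mod_simps numeral_eq_Suc)
  have sym: "(u, v) \<in> ?E" if "(v, u) \<in> ?E" for u v
    using that unfolding parcs_scycle_iff by blast
  \<comment> \<open>The middle edge from \<open>v\<close> to \<open>u\<close> is taken in the
    direction of the cycle. With \<open>i\<close>, \<open>j\<close>, \<open>k\<close>,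
    \<open>l\<close> consecutive and \<open>v\<close> at \<open>j\<close>, the end \<open>t\<close>
    lies at \<open>i\<close> or \<open>k\<close> and the end \<open>x\<close> at \<open>j\<close> or
    \<open>l\<close>.\<close>
  have forward: "?c v \<noteq> ?c u"
    "(t, v) \<in> ?E \<Longrightarrow> (u, x) \<in> ?E \<Longrightarrow> t \<noteq> u \<Longrightarrow> x \<noteq> v \<Longrightarrow> \<not> (?c t = ?c u \<and> ?c v = ?c x)"
    if vu: "(v, u) \<in> ?E" "vertex_index u = ?s (vertex_index v)" for t v u x
  proof -
    obtain i where "i < n" "vertex_index v = ?s i"
      using pred vu by (auto simp: parcs_scycle_iff)
    moreover obtain j k l where jkl: "j = ?s i" "k = ?s j" "l = ?s k" by blast
    ultimately have v: "v \<in> {Inl j, Inr j}" and u: "u \<in> {Inl k, Inr k}"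
      and index: "vertex_index v = j" "vertex_index u = k"
      and window: "window_ok (w ! i) (w ! j) (w ! k) (w ! l)" and "i < n" "j < n"
      using ok'[of i] vu(2) by (cases v; cases u; simp)+
    have isl: "isl v \<or> isl u"
      using vu by (simp add: parcs_scycle_iff)
    show "?c v \<noteq> ?c u"
      using window v u isl by (auto simp: window_ok_def)
    assume t: "(t, v) \<in> ?E" "t \<noteq> u" and x: "(u, x) \<in> ?E" "x \<noteq> v"
    have t': "vertex_index t = i \<or> vertex_index t = k" "isl t \<or> isl v"
      using vertex_index_neighbor[OF t(1) _ \<open>i < n\<close>] index jkl by metis+
    have x': "vertex_index x = j \<or> vertex_index x = l" "isl x \<or> isl u"
      using vertex_index_neighbor[OF sym[OF x(1)] _ \<open>j < n\<close>] index jkl by metis+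
    consider "v = Inl j" "u = Inl k" | "v = Inl j" "u = Inr k" | "v = Inr j" "u = Inl k"
      using v u isl by auto
    then show "\<not> (?c t = ?c u \<and> ?c v = ?c x)"
    proof cases
      case 1
      \<comment> \<open>At position \<open>k\<close> the end \<open>t\<close> differs from
        \<open>u\<close>, so it is the copy there; likewise for \<open>x\<close> at
        \<open>j\<close>.\<close>
      have t'': "?c t \<in> {fst (w ! i), snd (w ! i), snd (w ! k)}"
        using t(2) t' 1 by (cases t) auto
      have x'': "?c x \<in> {fst (w ! l), snd (w ! l), snd (w ! j)}"
        using x(2) x' 1 by (cases x) auto
      show ?thesis
      proof
        assume "?c t = ?c u \<and> ?c v = ?c x"
        then have "fst (w ! k) \<in> {fst (w ! i), snd (w ! i), snd (w ! k)}" "fst (w ! j) \<in> {fst (w ! l), snd (w ! l), snd (w ! j)}"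
          using t'' x'' 1 by simp_all
        then show False
          using window unfolding window_ok_def by blast
      qed
    next
      case 2
      have t'': "?c t \<in> {fst (w ! i), snd (w ! i), fst (w ! k)}"
        using t(2) t' 2 by (cases t) auto
      \<comment> \<open>A neighbor of the copy \<open>u\<close> is an original, and the original at
        \<open>j\<close> is \<open>v\<close> itself.\<close>
      have x'': "?c x = fst (w ! l)"
        using x(2) x' 2 by (cases x) auto
      show ?thesis
      proof
        assume "?c t = ?c u \<and> ?c v = ?c x"
        then have "snd (w ! k) \<in> {fst (w ! i), snd (w ! i), fst (w ! k)}" "fst (w ! j) = fst (w ! l)"
          using t'' x'' 2 by simp_all
        then show False
          using window unfolding window_ok_def by blast
      qed
    next
      case 3
      have t'': "?c t = fst (w ! i)"
        using t(2) t' 3 by (cases t) auto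
      have x'': "?c x \<in> {fst (w ! l), snd (w ! l), fst (w ! j)}"
        using x(2) x' 3 by (cases x) auto
      show ?thesis
      proof
        assume "?c t = ?c u \<and> ?c v = ?c x"
        then have "fst (w ! k) = fst (w ! i)" "snd (w ! j) \<in> {fst (w ! l), snd (w ! l), fst (w ! j)}"
          using t'' x'' 3 by simp_all
        then show False
          using window unfolding window_ok_def by blast
      qed
    qed
  qed
  have edge: "vertex_index u = ?s (vertex_index v) \<or> vertex_index v = ?s (vertex_index u)"
    if "(v, u) \<in> ?E" for u v
    using that unfolding parcs_scycle_iff by blast
  have "?c v \<noteq> ?c u" if "(v, u) \<in> ?E" for u v
    using edge[OF that] forward(1)[of v u] forward(1)[of u v] that sym by metis
  \<comment> \<open>If the middle edge runs backwards, \<open>forward\<close> is applied to the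
    reversed path.\<close>
  moreover have "\<not> (?c t = ?c u \<and> ?c v = ?c x)"
    if "(t, v) \<in> ?E" "(v, u) \<in> ?E" "(u, x) \<in> ?E" "distinct [t, v, u, x]" for t v u x
    using edge[OF that(2)] forward(2)[of v u t x] forward(2)[of u v x t] that sym
    by (metis distinct_length_2_or_more)
  ultimately show ?thesis
    by (auto simp: star_coloring_iff[OF pair_graph_scycle[OF n(2)]] proper_coloring_def)
qed

text \<open>Windows are taken without wrapping around, so that simplification can evaluate the check
  on concrete words.\<close>

fun windows_ok :: "(nat \<times> nat) list \<Rightarrow> bool" where
  "windows_ok (p # q # r # s # w) \<longleftrightarrow> window_ok p q r s \<and> windows_ok (q # r # s # w)"
| "windows_ok _ \<longleftrightarrow> True"

lemma windows_ok_nth: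
  "windows_ok w \<Longrightarrow> i + 3 < length w \<Longrightarrow>
     window_ok (w ! i) (w ! (i + 1)) (w ! (i + 2)) (w ! (i + 3))"
proof (induction w arbitrary: i rule: windows_ok.induct)
  case (1 p q r s w)
  then show ?case
    by (cases i) (auto simp: numeral_eq_Suc)
qed auto

text \<open>Repeating the first three letters at the end turns the windows that wrap around into
  ordinary ones.\<close>

lemma star_coloring_if_windows_ok:
  assumes "length w \<ge> 3" "windows_ok (w @ take 3 w)"
  shows "star_coloring (scycle (length w)) (word_coloring w)"
proof (rule star_coloring_word_coloring)
  let ?n = "length w"
  have nth: "(w @ take 3 w) ! m = w ! (m mod ?n)" if "m < ?n + 3" for m
    using that assms(1) by (cases "m < ?n") (auto simp: nth_append mod_if)
  fix i assume "i < ?n"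
  then show "window_ok (w ! i) (w ! ((i + 1) mod ?n)) (w ! ((i + 2) mod ?n)) (w ! ((i + 3) mod ?n))"
    using windows_ok_nth[OF assms(2), of i] assms(1) by (simp add: nth)
qed (use assms in auto)

lemma star_chromatic_number_le:
  assumes "star_coloring G c" "card (c ` pverts G) \<le> k"
  shows "star_chromatic_number G \<le> k"
  unfolding star_chromatic_number_def using assms by (auto intro: Least_le[THEN order_trans])

lemma star_chromatic_number_scycle_le:
  assumes "length w \<ge> 3" "windows_ok (w @ take 3 w)" "set w \<subseteq> {..<k} \<times> {..<k}"
  shows "star_chromatic_number (scycle (length w)) \<le> k"
proof (rule star_chromatic_number_le)
  show "star_coloring (scycle (length w)) (word_coloring w)"
    using assms by (intro star_coloring_if_windows_ok)
  have "fst (w ! i) < k \<and> snd (w ! i) < k" if "i < length w" for i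
    using that assms(3) nth_mem by fastforce
  then have "word_coloring w ` pverts (scycle (length w)) \<subseteq> {..<k}"
    by (auto simp: pverts_scycle)
  then show "card (word_coloring w ` pverts (scycle (length w))) \<le> k"
    using card_mono[of "{..<k}"] by fastforce
qed

section \<open>Upper bounds from periodic colorings\<close>

fun periodic_word :: "nat \<Rightarrow> (nat \<times> nat) list \<Rightarrow> (nat \<times> nat) list" where
  "periodic_word 0 v = v"
| "periodic_word (Suc k) v = (0, 0) # (1, 3) # (2, 3) # periodic_word k v"

lemma length_periodic_word [simp]: "length (periodic_word k v) = 3 * k + length v"
  by (induction k) auto

lemma set_periodic_word: "set (periodic_word k v) \<subseteq> {(0, 0), (1, 3), (2, 3)} \<union> set v"
  by (induction k) auto

text \<open>Prepending a further period adds three windows, all inside two consecutive periods,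
  where they are valid whatever \<open>v\<close> is. With \<open>Suc k\<close> the word starts with
  a period, which is what \<open>take 3\<close> repeats at the end.\<close>

lemma windows_ok_periodic_word:
  assumes "windows_ok (periodic_word 1 (v @ periodic_word 1 []))"
  shows "windows_ok (periodic_word (Suc k) v @ take 3 (periodic_word (Suc k) v))"
proof -
  have append: "periodic_word k v @ u = periodic_word k (v @ u)" for k u
    by (induction k) auto
  have "windows_ok (periodic_word (Suc k) (v @ periodic_word 1 []))"
    using assms
    by (induction k) (auto simp: window_ok_def)
  moreover have "take 3 (periodic_word (Suc k) v) = periodic_word 1 []"
    by (simp add: numeral_eq_Suc)
  ultimately show ?thesis
    by (metis append)
qed

lemma star_chromatic_number_le_periodic_word:
  assumes "n = 3 * Suc k + length v" "windows_ok (periodic_word 1 (v @ periodic_word 1 []))"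
    and "set v \<subseteq> {..<m} \<times> {..<m}" "m \<ge> 4"
  shows "star_chromatic_number (scycle n) \<le> m"
proof -
  have "set (periodic_word (Suc k) v) \<subseteq> {..<m} \<times> {..<m}"
    using set_periodic_word[of "Suc k" v] assms(3,4) by auto
  then show ?thesis
    using star_chromatic_number_scycle_le[of "periodic_word (Suc k) v" m]
      windows_ok_periodic_word[OF assms(2), of k] assms(1)
    by (metis length_periodic_word le_add1 mult_Suc_right trans_le_add1)
qed

lemma star_chromatic_number_scycle_le_4:
  assumes "n \<ge> 3" "n mod 3 \<noteq> 1" "n \<noteq> 5"
  shows "star_chromatic_number (scycle n) \<le> 4"
proof -
  \<comment> \<open>If \<open>n mod 3 = 2\<close>, then \<open>n \<noteq> 5\<close> forces
    \<open>n \<ge> 8\<close>, so at least one period remains beside the inserted five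
    letters.\<close>
  consider k where "n = 3 * Suc k" | k where "n = 3 * Suc k + 5"
  proof (cases "n mod 3 = 0")
    case True
    then have "n = 3 * Suc (n div 3 - 1)"
      using assms(1) by presburger
    then show ?thesis using that by blast
  next
    case False
    then have "n = 3 * Suc (n div 3 - 2) + 5"
      using assms by presburger
    then show ?thesis using that by blast
  qed
  then show ?thesis
  proof cases
    case 1
    then show ?thesis
      using star_chromatic_number_le_periodic_word[of n _ "[]" 4] by (simp add: window_ok_def)
  next
    case 2
    then show ?thesis
      \<comment> \<open>As in the period, a copy has color 0 if its original has, and color 3
        otherwise.\<close>
      using star_chromatic_number_le_periodic_word[of n _ "[(1, 3), (0, 0), (2, 3), (1, 3), (2, 3)]" 4]
      by (simp add: window_ok_def)
  qed
qed

lemma star_chromatic_number_scycle_le_5: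
  assumes "n \<ge> 3" "n mod 3 = 1 \<or> n = 5"
  shows "star_chromatic_number (scycle n) \<le> 5"
proof (cases "n = 5")
  case True
  then show ?thesis
    \<comment> \<open>The originals get five different colors, and each copy takes the color of the
      original two positions further on.\<close>
    using star_chromatic_number_scycle_le[of "[(0, 1), (2, 3), (1, 4), (3, 0), (4, 2)]" 5]
    by (simp add: window_ok_def eval_nat_numeral)
next
  case False
  with assms have "n = 3 * Suc (n div 3 - 1) + 1"
    by presburger
  then have "n = 3 * Suc (n div 3 - 1) + length [(4 :: nat, 3 :: nat)]"
    by simp
  then show ?thesis
    by (rule star_chromatic_number_le_periodic_word) (auto simp: window_ok_def)
qed

section \<open>The lower bound\<close>

lemma card_star_coloring_scycle_ge_4:
  fixes c :: "nat + nat \<Rightarrow> nat"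
  assumes n: "n \<ge> 3" and star: "star_coloring (scycle n) c"
  shows "card (c ` pverts (scycle n)) \<ge> 4"
proof (rule ccontr)
  assume less: "\<not> card (c ` pverts (scycle n)) \<ge> 4"
  \<comment> \<open>Periodic color sequences on all naturals, so that later indices can grow without
    wrapping around.\<close>
  define a b where "a i = c (Inl (i mod n))" and "b i = c (Inr (i mod n))" for i
  have mem: "a i \<in> c ` pverts (scycle n)" "b i \<in> c ` pverts (scycle n)" for i
    using n by (auto simp: a_def b_def pverts_scycle)
  have fin: "finite (c ` pverts (scycle n))"
    by (simp add: pverts_scycle)
  have three: "\<not> distinct [p, q, r, s]" if "set [p, q, r, s] \<subseteq> c ` pverts (scycle n)" for p q r s
    using less card_mono[OF fin that] distinct_card[of "[p, q, r, s]"] by force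
  have arcs:
    "(Inl (i mod n), Inl (Suc i mod n)) \<in> parcs (scycle n)"
    "(Inl (Suc i mod n), Inl (i mod n)) \<in> parcs (scycle n)"
    "(Inl (i mod n), Inr (Suc i mod n)) \<in> parcs (scycle n)"
    "(Inr (Suc i mod n), Inl (i mod n)) \<in> parcs (scycle n)"
    "(Inr (i mod n), Inl (Suc i mod n)) \<in> parcs (scycle n)"
    "(Inl (Suc i mod n), Inr (i mod n)) \<in> parcs (scycle n)" for i
    using n by (simp_all add: parcs_scycle_iff mod_simps)
  have proper: "c x \<noteq> c y" if "(x, y) \<in> parcs (scycle n)" for x y
    using star that by (auto simp: star_coloring_def proper_coloring_def)
  have path: "\<not> (c u = c w \<and> c v = c x)"
    if "(u, v) \<in> parcs (scycle n)" "(v, w) \<in> parcs (scycle n)" "(w, x) \<in> parcs (scycle n)"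
      "distinct [u, v, w, x]" for u v w x
    using star that unfolding star_coloring_iff[OF pair_graph_scycle[OF n]] by blast
  have shift: "Suc i mod n \<noteq> i mod n" "Suc (Suc i) mod n \<noteq> i mod n" "Suc (Suc i) mod n \<noteq> Suc i mod n"
    for i
    using n by (auto simp: mod_Suc)
  have shift3: "Suc (Suc (Suc i)) mod n \<noteq> i mod n" if "n \<noteq> 3" for i
    using n that by (auto simp: mod_Suc)
  have adj: "a i \<noteq> a (Suc i)" "a i \<noteq> b (Suc i)" "b i \<noteq> a (Suc i)" for i
    unfolding a_def b_def by (intro proper arcs)+
  have copies: "\<not> (b i = a i \<and> a (Suc i) = b (Suc i))" for i
    using path[of "Inr (i mod n)" "Inl (Suc i mod n)" "Inl (i mod n)" "Inr (Suc i mod n)"] shift[of i]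
    by (auto simp: a_def b_def arcs)
  \<comment> \<open>The original and the copy at \<open>Suc i\<close> form a 4-cycle with the
    originals on both sides.\<close>
  have square: "\<not> (a i = a (Suc (Suc i)) \<and> a (Suc i) = b (Suc i))" for i
    using path[of "Inl (i mod n)" "Inl (Suc i mod n)" "Inl (Suc (Suc i) mod n)" "Inr (Suc i mod n)"]
      shift[of i] shift[of "Suc i"]
    by (auto simp: a_def b_def arcs)
  \<comment> \<open>For \<open>n = 3\<close> the first and fourth positions coincide and the path
    argument breaks down, but then positions \<open>i\<close> and \<open>i + 2\<close> are
    adjacent.\<close>
  have triangle: "a i \<noteq> a (Suc (Suc i))" if "n = 3" for i
  proof -
    have "Suc (Suc (Suc i)) mod 3 = i mod 3"
      by presburger
    then have "a (Suc (Suc (Suc i))) = a i"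
      by (simp only: a_def that)
    then show ?thesis
      using adj(1)[of "Suc (Suc i)"] by metis
  qed
  have cycle: "\<not> (a i = a (Suc (Suc i)) \<and> a (Suc i) = a (Suc (Suc (Suc i))))"
    and via_copy: "\<not> (a i = b (Suc (Suc i)) \<and> a (Suc i) = a (Suc (Suc (Suc i))))" for i
  proof -
    have "\<not> (a i = a (Suc (Suc i)) \<and> a (Suc i) = a (Suc (Suc (Suc i)))) \<and>
      \<not> (a i = b (Suc (Suc i)) \<and> a (Suc i) = a (Suc (Suc (Suc i))))"
    proof (cases "n = 3")
      case True
      then show ?thesis
        using triangle[OF True, of i] triangle[OF True, of "Suc i"] by blast
    next
      case False
      then show ?thesis
        unfolding a_def b_def using shift[of i] shift[of "Suc i"] shift3[OF False, of i]
        by (intro conjI path arcs) simp_all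
    qed
    then show "\<not> (a i = a (Suc (Suc i)) \<and> a (Suc i) = a (Suc (Suc (Suc i))))"
      and "\<not> (a i = b (Suc (Suc i)) \<and> a (Suc i) = a (Suc (Suc (Suc i))))"
      by blast+
  qed
  \<comment> \<open>Both neighbors avoid the two different colors at \<open>Suc i\<close>, so only
    the third color is left for them.\<close>
  have disagree: "a i = a (Suc (Suc i))" if "a (Suc i) \<noteq> b (Suc i)" for i
    using three[of "a i" "a (Suc (Suc i))" "a (Suc i)" "b (Suc i)"] mem that
      adj[of i] adj[of "Suc i"] by auto
  have alternate: "a (Suc i) = b (Suc i) \<longleftrightarrow> a (Suc (Suc i)) \<noteq> b (Suc (Suc i))" for i
    using copies[of "Suc i"] disagree[of i] disagree[of "Suc i"] cycle[of i] by metis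
  obtain i where i: "a (Suc i) = b (Suc i)"
    using alternate[of 0] by blast
  have no4: "a (Suc (Suc (Suc (Suc i)))) \<noteq> b (Suc (Suc (Suc (Suc i))))"
    and yes3: "a (Suc (Suc (Suc i))) = b (Suc (Suc (Suc i)))"
    using i alternate[of i] alternate[of "Suc i"] alternate[of "Suc (Suc i)"] by auto
  have "a (Suc (Suc i)) \<noteq> a (Suc (Suc (Suc (Suc i))))"
    using square[of "Suc (Suc i)"] yes3 by metis
  \<comment> \<open>The originals at \<open>i + 2\<close>, \<open>i + 3\<close>,
    \<open>i + 4\<close> now show all three colors, and the copy at \<open>i + 4\<close> avoids the
    last two.\<close>
  then have "b (Suc (Suc (Suc (Suc i)))) = a (Suc (Suc i))"
    using three[of "b (Suc (Suc (Suc (Suc i))))" "a (Suc (Suc i))" "a (Suc (Suc (Suc (Suc i))))" "a (Suc (Suc (Suc i)))"]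
      mem no4 adj[of "Suc (Suc i)"] adj[of "Suc (Suc (Suc i))"] by auto
  \<comment> \<open>The bicolored path runs through the originals at \<open>i + 2\<close> and
    \<open>i + 3\<close>, the copy at \<open>i + 4\<close> and the original at
    \<open>i + 5\<close>.\<close>
  then show False
    using via_copy[of "Suc (Suc i)"] disagree[OF no4] by metis
qed

text \<open>Some star coloring exists, so the \<open>LEAST\<close> is a genuine minimum and a bound
  for every star coloring passes to it.\<close>

lemma star_chromatic_number_attained:
  assumes "pair_graph G"
  obtains c where "star_coloring G c" "card (c ` pverts G) = star_chromatic_number G"
proof -
  have "\<exists>k c. star_coloring G c \<and> card (c ` pverts G) = k"
    using ex_star_coloring[OF assms] by blast
  from LeastI_ex[OF this] show thesis
    using that unfolding star_chromatic_number_def by blast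
qed

theorem theorem5:
  fixes n :: nat
  assumes "n \<ge> 3"
  shows "if \<not> [n = 1] (mod 3) \<and> n \<noteq> 5
         then star_chromatic_number (splitting_graph (cycle_graph n)) = 4
         else star_chromatic_number (splitting_graph (cycle_graph n)) \<le> 5"
proof -
  have "star_chromatic_number (scycle n) \<ge> 4"
    using star_chromatic_number_attained[OF pair_graph_scycle[OF assms]]
      card_star_coloring_scycle_ge_4[OF assms] by metis
  then show ?thesis
    using star_chromatic_number_scycle_le_4[OF assms] star_chromatic_number_scycle_le_5[OF assms]
    by (auto simp: cong_def intro: antisym)
qed

end
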